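(* Let $\hat\Sigma\in\mathbf{Q}_n$, $\hat\Sigma\succ0$, and let $0<\delta<\delta_{max}:=\log|\mathrm{diag}^2(\hat\Sigma^{-1})\hat\Sigma|$. Let $$\tilde J(\lambda,\Gamma,\Theta):=\lambda\left(-\log\left|\hat\Sigma^{-1}+\lambda^{-1}(\mathrm{ofd}(\Theta)-\Gamma)\right|-\log|\hat\Sigma|+\delta\right),$$ $$\mathcal{C}_0:=\{(\lambda,\Gamma,\Theta)\in\mathbb{R}\times\mathbf{Q}_n\times\mathbf{Q}_n:\ \lambda>0,\ I+\Gamma-\mathrm{ofd}(\Theta)\succeq0,\ \Gamma\succeq0,\ \hat\Sigma^{-1}+\lambda^{-1}(\mathrm{ofd}(\Theta)-\Gamma)\succ0\}.$$ Then there exist constants $0<\varepsilon\le M<\infty$, $\rho\in\mathbb{R}$, $0<\alpha<\infty$ and $\beta>0$ such that, with $$\mathcal{C}:=\{(\lambda,\Gamma,\Theta):\ \varepsilon\le\lambda\le M,\ \rho I\preceq\Theta-\Gamma\preceq I,\ 0\preceq\Gamma\preceq\alpha I,\ \Gamma\in\mathbf{D}_n,\ \Theta\in\mathbf{M}_n,\ \hat\Sigma^{-1}+\lambda^{-1}(\Theta-\Gamma)\succeq\beta I\}\subset\mathcal{C}_0,$$ the problem $\min_{(\lambda,\Gamma,\Theta)\in\mathcal{C}_0}\tilde J(\lambda,\Gamma,\Theta)$ is equivalent to the problem $\min_{(\lambda,\Gamma,\Theta)\in\mathcal{C}}\tilde J(\lambda,\Gamma,\Theta)$ (i.e. the two infima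 coincide), and both these problems admit a solution (i.e. both infima are attained).
   Context: $\mathbf{Q}_n$ is the space of real symmetric $n\times n$ matrices, $\mathbf{D}_n\subset\mathbf{Q}_n$ the subspace of diagonal matrices, and $\mathbf{M}_n\subset\mathbf{Q}_n$ the subspace of symmetric matrices with zero main diagonal. $|M|$ is the determinant of $M$. $\mathrm{diag}^2(M)$ is the diagonal matrix with the same main diagonal as $M$; $\mathrm{ofd}(M)=M-\mathrm{diag}^2(M)$ for $M\in\mathbf{Q}_n$ (so $\mathrm{ofd}(\Theta)=\Theta$ for $\Theta\in\mathbf{M}_n$). *)

theory Defs
  imports "HOL-Analysis.Analysis"
begin

definition symmetric_matrices :: "(real ^ 'n ^ 'n) set" where
  "symmetric_matrices = {A. transpose A = A}"

definition diagonal_matrices :: "(real ^ 'n ^ 'n) set" where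
  "diagonal_matrices = {A \<in> symmetric_matrices. \<forall>i j. i \<noteq> j \<longrightarrow> A $ i $ j = 0}"

definition hollow_matrices :: "(real ^ 'n ^ 'n) set" where
  "hollow_matrices = {A \<in> symmetric_matrices. \<forall>i. A $ i $ i = 0}"

definition diag2 :: "real ^ 'n ^ 'n \<Rightarrow> real ^ 'n ^ 'n" where
  "diag2 A = (\<chi> i j. if i = j then A $ i $ j else 0)"

definition ofd :: "real ^ 'n ^ 'n \<Rightarrow> real ^ 'n ^ 'n" where
  "ofd A = A - diag2 A"

text \<open>Definiteness includes symmetry.\<close>

definition pos_def :: "real ^ 'n ^ 'n \<Rightarrow> bool" where
  "pos_def A \<longleftrightarrow> A \<in> symmetric_matrices \<and> (\<forall>x. x \<noteq> 0 \<longrightarrow> x \<bullet> (A *v x) > 0)"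

definition pos_semidef :: "real ^ 'n ^ 'n \<Rightarrow> bool" where
  "pos_semidef A \<longleftrightarrow> A \<in> symmetric_matrices \<and> (\<forall>x. x \<bullet> (A *v x) \<ge> 0)"

definition loewner_le :: "real ^ 'n ^ 'n \<Rightarrow> real ^ 'n ^ 'n \<Rightarrow> bool"  (infix \<open>\<preceq>\<close> 50) where
  "A \<preceq> B \<longleftrightarrow> pos_semidef (B - A)"

definition delta_max :: "real ^ 'n ^ 'n \<Rightarrow> real" where
  "delta_max \<Sigma> = ln (det (diag2 (matrix_inv \<Sigma>) ** \<Sigma>))"

text \<open>Triples are \<open>(l, \<Gamma>, \<Theta>)\<close>, where \<open>l\<close> is the multiplier usually written
  as a lambda.  The feasible sets below keep the argument of the first \<open>ln\<close> positive.\<close>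

definition J_dual ::
  "real ^ 'n ^ 'n \<Rightarrow> real \<Rightarrow> real \<times> (real ^ 'n ^ 'n) \<times> (real ^ 'n ^ 'n) \<Rightarrow> real" where
  "J_dual \<Sigma> \<delta> = (\<lambda>(l, \<Gamma>, \<Theta>).
     l * (- ln (det (matrix_inv \<Sigma> + inverse l *\<^sub>R (ofd \<Theta> - \<Gamma>))) - ln (det \<Sigma>) + \<delta>))"

definition feasible ::
  "real ^ 'n ^ 'n \<Rightarrow> (real \<times> (real ^ 'n ^ 'n) \<times> (real ^ 'n ^ 'n)) set" where
  "feasible \<Sigma> = {(l, \<Gamma>, \<Theta>).
     \<Gamma> \<in> symmetric_matrices \<and> \<Theta> \<in> symmetric_matrices \<and> l > 0 \<and>
     pos_semidef (mat 1 + \<Gamma> - ofd \<Theta>) \<and> pos_semidef \<Gamma> \<and>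
     pos_def (matrix_inv \<Sigma> + inverse l *\<^sub>R (ofd \<Theta> - \<Gamma>))}"

definition restricted_feasible ::
  "real ^ 'n ^ 'n \<Rightarrow> real \<Rightarrow> real \<Rightarrow> real \<Rightarrow> real \<Rightarrow> real \<Rightarrow>
    (real \<times> (real ^ 'n ^ 'n) \<times> (real ^ 'n ^ 'n)) set" where
  "restricted_feasible \<Sigma> \<epsilon> M \<rho> \<alpha> \<beta> = {(l, \<Gamma>, \<Theta>).
     \<epsilon> \<le> l \<and> l \<le> M \<and>
     \<rho> *\<^sub>R mat 1 \<preceq> \<Theta> - \<Gamma> \<and> \<Theta> - \<Gamma> \<preceq> mat 1 \<and>
     0 \<preceq> \<Gamma> \<and> \<Gamma> \<preceq> \<alpha> *\<^sub>R mat 1 \<and>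
     \<Gamma> \<in> diagonal_matrices \<and> \<Theta> \<in> hollow_matrices \<and>
     \<beta> *\<^sub>R mat 1 \<preceq> matrix_inv \<Sigma> + inverse l *\<^sub>R (\<Theta> - \<Gamma>)}"

end

(*
Write P for the inverse of \<Sigma>, X = ofd \<Theta> - \<Gamma> and Z = P + X / l. The objective depends on (l, X) only,
so every feasible point may be replaced by the one with the diagonal part of \<Gamma> and a hollow \<Theta>
having the same X. For positive definite A and B one has
ln (det A) + ln (det B) <= trace (A B) - n. With A the inverse of the diagonal part of P this is
Hadamard's inequality and gives J >= l (\<delta> - delta_max); with A = \<Sigma> it gives J >= l \<delta> - trace \<Sigma>.
Both are compared with the point where Z is the diagonal part of P, whose value
l0 (\<delta> - delta_max) is negative: a point that is no worse has l0 <= l <= trace \<Sigma> / \<delta>, and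
J < 0 forces det Z > exp \<delta> / det \<Sigma>, which with the bound Z_ii <= P_ii keeps the spectrum of Z
away from 0. The remaining points form a compact set on which J is continuous.
*)
theory Submission
  imports Defs
begin

section \<open>Spectral theorem for real symmetric matrices\<close>

lemma inner_matrix_vector_symmetric:
  fixes A :: "real ^ 'n ^ 'n"
  assumes "transpose A = A"
  shows "x \<bullet> (A *v y) = (A *v x) \<bullet> y"
  by (metis assms dot_lmul_matrix transpose_matrix_vector)

text \<open>If the form vanishes at x, then its value at x + t y is 2 t c + t^2 d with c the mixed
  term; being nonnegative for every t, it forces c = 0. Taking \<open>V\<close> to be an orthogonal
  complement serves the construction of eigenvectors, taking \<open>V = UNIV\<close> identifies
  kernels.\<close>

lemma psd_on_subspace_inner_eq_0:
  fixes B :: "real ^ 'n ^ 'n"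
  assumes "transpose B = B" "subspace V" "\<And>v. v \<in> V \<Longrightarrow> v \<bullet> (B *v v) \<ge> 0"
    and "x \<in> V" "y \<in> V" "x \<bullet> (B *v x) = 0"
  shows "y \<bullet> (B *v x) = 0"
proof -
  define c where "c = y \<bullet> (B *v x)"
  define d where "d = y \<bullet> (B *v y)"
  have d: "d \<ge> 0" using assms by (simp add: d_def)
  have c': "x \<bullet> (B *v y) = c"
    using inner_matrix_vector_symmetric[OF assms(1), of x y] by (simp add: c_def inner_commute)
  \<comment> \<open>The natural choice - c / d fails for d = 0; the shifted denominator still makes
    the value negative unless c = 0.\<close>
  define t where "t = - c / (d + 1)"
  have "x + t *\<^sub>R y \<in> V"
    using assms by (simp add: subspace_add subspace_scale)
  then have "(x + t *\<^sub>R y) \<bullet> (B *v (x + t *\<^sub>R y)) \<ge> 0"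
    using assms by blast
  then have "2 * t * c + t * t * d \<ge> 0"
    using assms(6) c'
    by (simp add: c_def d_def matrix_vector_right_distrib matrix_vector_mult_scaleR
        inner_add_left inner_add_right algebra_simps)
  moreover have "2 * t * c + t * t * d = - (c\<^sup>2 * (d + 2) / (d + 1)\<^sup>2)"
  proof -
    have c: "c = - t * (d + 1)" using d by (simp add: t_def)
    have "c\<^sup>2 * (d + 2) / (d + 1)\<^sup>2 = t\<^sup>2 * (d + 2)"
      using d by (simp add: c power_mult_distrib)
    then show ?thesis by (simp add: c power2_eq_square algebra_simps)
  qed
  ultimately have "c\<^sup>2 * (d + 2) / (d + 1)\<^sup>2 \<le> 0" by simp
  then have "c\<^sup>2 * (d + 2) \<le> 0" using d by (simp add: divide_le_0_iff)
  then have "c\<^sup>2 \<le> 0" using d by (simp add: mult_le_0_iff)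
  then show ?thesis by (simp add: c_def)
qed

text \<open>The orthogonal complement \<open>V\<close> of the known eigenvectors is nonzero and
  invariant under \<open>A\<close>, so the Rayleigh quotient has a maximizer on its unit sphere.
  This maximizer is an eigenvector: with m the maximum, m I - A is nonnegative on \<open>V\<close>
  and vanishes at x.\<close>

lemma symmetric_matrix_eigenvector_extend:
  fixes A :: "real ^ 'n ^ 'n"
  assumes A: "transpose A = A" and S: "finite S" "card S < CARD('n)"
    and eig: "\<And>s. s \<in> S \<Longrightarrow> \<exists>m. A *v s = m *\<^sub>R s"
  obtains x m where "norm x = 1" "A *v x = m *\<^sub>R x" "\<And>s. s \<in> S \<Longrightarrow> s \<bullet> x = 0"
proof -
  define V where "V = {x. \<forall>s\<in>S. s \<bullet> x = 0}"
  have V: "subspace V"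
    by (auto simp: V_def subspace_def inner_right_distrib)
  have AV: "A *v v \<in> V" if "v \<in> V" for v
  proof -
    have "s \<bullet> (A *v v) = 0" if "s \<in> S" for s
    proof -
      obtain m where "A *v s = m *\<^sub>R s" using eig \<open>s \<in> S\<close> by blast
      then show ?thesis
        using \<open>v \<in> V\<close> \<open>s \<in> S\<close> by (simp add: V_def inner_matrix_vector_symmetric[OF A])
    qed
    then show ?thesis by (simp add: V_def)
  qed
  have "dim (span S) < DIM(real ^ 'n)"
    using dim_le_card'[OF S(1)] S(2) by simp
  then obtain y where y: "y \<noteq> 0" "\<And>s. s \<in> span S \<Longrightarrow> orthogonal y s"
    using orthogonal_to_subspace_exists by (metis dim_span)
  have yV: "y \<in> V"
    using y(2) by (auto simp: V_def orthogonal_def span_base inner_commute)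
  let ?K = "V \<inter> sphere 0 1"
  have "closed V" using V closed_subspace by blast
  then have cK: "compact ?K" by (simp add: closed_Int_compact)
  have "(1 / norm y) *\<^sub>R y \<in> ?K"
    using y yV V by (auto intro: subspace_scale)
  then have nK: "?K \<noteq> {}" by blast
  have "continuous_on ?K (\<lambda>x. x \<bullet> (A *v x))"
    by (intro continuous_intros linear_continuous_on) (simp add: bounded_linear_mult_right)
  then obtain x where x: "x \<in> ?K" and mx: "\<And>z. z \<in> ?K \<Longrightarrow> z \<bullet> (A *v z) \<le> x \<bullet> (A *v x)"
    using continuous_attains_sup[OF cK nK] by blast
  define m where "m = x \<bullet> (A *v x)"
  define B where "B = m *\<^sub>R mat 1 - A"
  have Bv: "B *v v = m *\<^sub>R v - A *v v" for v
    by (simp add: B_def matrix_vector_mult_diff_rdistrib scaleR_matrix_vector_assoc[symmetric])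
  have trB: "transpose B = B"
    using A by (auto simp: B_def transpose_def vec_eq_iff mat_def)
  have xx: "x \<bullet> x = 1" using x by (simp add: norm_eq_1)
  have "v \<bullet> (B *v v) \<ge> 0" if "v \<in> V" for v
  proof (cases "v = 0")
    case False
    have "(1 / norm v) *\<^sub>R v \<in> ?K"
      using False that V by (auto intro: subspace_scale)
    from mx[OF this] have "(v \<bullet> (A *v v)) / (norm v)\<^sup>2 \<le> m"
      by (simp add: m_def matrix_vector_mult_scaleR power2_eq_square)
    then show ?thesis
      using False by (simp add: Bv inner_diff_right field_simps power2_norm_eq_inner)
  qed simp
  moreover have "x \<bullet> (B *v x) = 0"
    by (simp add: Bv inner_diff_right xx m_def)
  moreover have "B *v x \<in> V" using x AV V
    by (auto simp: Bv intro: subspace_diff subspace_scale)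
  \<comment> \<open>\<open>B *v x\<close> is orthogonal to all of \<open>V\<close> and lies in
    \<open>V\<close> itself, so it is orthogonal to itself.\<close>
  ultimately have "(B *v x) \<bullet> (B *v x) = 0"
    using psd_on_subspace_inner_eq_0[OF trB V] x by blast
  then have "A *v x = m *\<^sub>R x" by (simp add: Bv)
  with x show ?thesis by (intro that[of x m]) (auto simp: V_def)
qed

lemma symmetric_matrix_orthonormal_eigenbasis:
  fixes A :: "real ^ 'n ^ 'n"
  assumes A: "transpose A = A"
  obtains q :: "'n \<Rightarrow> real ^ 'n" and d :: "'n \<Rightarrow> real"
  where "\<And>i j. q i \<bullet> q j = (if i = j then 1 else 0)" "\<And>i. A *v q i = d i *\<^sub>R q i"
proof -
  have "\<exists>S :: (real ^ 'n) set. finite S \<and> card S = k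
      \<and> (\<forall>s\<in>S. norm s = 1 \<and> (\<exists>m. A *v s = m *\<^sub>R s))
      \<and> (\<forall>s\<in>S. \<forall>t\<in>S. s \<noteq> t \<longrightarrow> s \<bullet> t = 0)" if "k \<le> CARD('n)" for k
    using that
  proof (induction k)
    case 0
    then show ?case by (intro exI[of _ "{}"]) simp
  next
    case (Suc k)
    then obtain S :: "(real ^ 'n) set" where S: "finite S" "card S = k"
      "\<forall>s\<in>S. norm s = 1 \<and> (\<exists>m. A *v s = m *\<^sub>R s)"
      "\<forall>s\<in>S. \<forall>t\<in>S. s \<noteq> t \<longrightarrow> s \<bullet> t = 0" by auto
    obtain x m where x: "norm x = 1" "A *v x = m *\<^sub>R x" "\<And>s. s \<in> S \<Longrightarrow> s \<bullet> x = 0"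
      using symmetric_matrix_eigenvector_extend[OF A S(1)] S Suc.prems by (metis Suc_le_lessD)
    have "x \<notin> S" using x by force
    then have "card (insert x S) = Suc k" using S by simp
    then show ?case using S x
      by (intro exI[of _ "insert x S"]) (auto simp: inner_commute)
  qed
  from this[of "CARD('n)"] obtain S :: "(real ^ 'n) set" where S: "finite S" "card S = CARD('n)"
      "\<And>s. s \<in> S \<Longrightarrow> norm s = 1" "\<And>s. s \<in> S \<Longrightarrow> \<exists>m. A *v s = m *\<^sub>R s"
      "\<And>s t. s \<in> S \<Longrightarrow> t \<in> S \<Longrightarrow> s \<noteq> t \<Longrightarrow> s \<bullet> t = 0"
    by auto
  \<comment> \<open>The full set of orthonormal eigenvectors is indexed by the coordinate type, so
    that its members can become the columns of a matrix.\<close>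
  obtain q where q: "bij_betw q (UNIV :: 'n set) S"
    using finite_same_card_bij[OF finite_class.finite_UNIV S(1)] S(2) by metis
  then have qS: "q i \<in> S" for i by (auto simp: bij_betw_def)
  have "q i \<bullet> q j = (if i = j then 1 else 0)" for i j
    using S(3)[OF qS[of i]] S(5)[OF qS qS, of i j] q
    by (auto simp: bij_betw_def inj_eq norm_eq_1)
  moreover obtain d where "\<And>i. A *v q i = d i *\<^sub>R q i"
    using S(4)[OF qS] by metis
  ultimately show ?thesis by (rule that)
qed

definition diagonal_matrix_of :: "('n \<Rightarrow> real) \<Rightarrow> real ^ 'n ^ 'n" where
  "diagonal_matrix_of d = (\<chi> i j. if i = j then d i else 0)"

lemma matrix_mult_diagonal_matrix_of: "(A ** diagonal_matrix_of d) $ i $ j = A $ i $ j * d j"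
  by (simp add: matrix_matrix_mult_def diagonal_matrix_of_def if_distrib cong: if_cong)

lemma diagonal_matrix_of_mult: "(diagonal_matrix_of d ** A) $ i $ j = d i * A $ i $ j"
  by (simp add: matrix_matrix_mult_def diagonal_matrix_of_def if_distrib if_distribR cong: if_cong)

lemma det_diagonal_matrix_of: "det (diagonal_matrix_of d) = prod d UNIV"
  by (subst det_diagonal) (simp_all add: diagonal_matrix_of_def)

lemma trace_diagonal_matrix_of: "trace (diagonal_matrix_of d) = sum d UNIV"
  by (simp add: trace_def diagonal_matrix_of_def)

text \<open>Matrix form of the eigenbasis. The last two facts present each eigenvalue as the value
  of the quadratic form at a unit vector, which lets definiteness of \<open>A\<close> be read off as
  a sign condition on \<open>d\<close>.\<close>

lemma symmetric_matrix_diagonalization: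
  fixes A :: "real ^ 'n ^ 'n"
  assumes A: "transpose A = A"
  obtains Q d where "orthogonal_matrix Q" "A = Q ** diagonal_matrix_of d ** transpose Q"
    and "\<And>i. norm (column i Q) = 1" "\<And>i. column i Q \<bullet> (A *v column i Q) = d i"
proof -
  obtain q :: "'n \<Rightarrow> real ^ 'n" and d where
    q: "\<And>i j. q i \<bullet> q j = (if i = j then 1 else 0)" and d: "\<And>i. A *v q i = d i *\<^sub>R q i"
    using symmetric_matrix_orthonormal_eigenbasis[OF A] by metis
  define Q :: "real ^ 'n ^ 'n" where "Q = (\<chi> i j. q j $ i)"
  have col: "column i Q = q i" for i
    by (simp add: column_def Q_def vec_eq_iff)
  have "transpose Q ** Q = mat 1"
    using q by (simp add: vec_eq_iff matrix_matrix_mult_def transpose_def Q_def mat_def inner_vec_def)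
  then have Q: "orthogonal_matrix Q"
    by (simp add: orthogonal_matrix)
  then have QQ: "Q ** transpose Q = mat 1"
    by (simp add: orthogonal_matrix_def)
  have "(A ** Q) $ i $ j = (A *v q j) $ i" for i j
    by (simp add: matrix_matrix_mult_def matrix_vector_mult_def Q_def)
  then have "A ** Q = Q ** diagonal_matrix_of d"
    by (simp add: vec_eq_iff matrix_mult_diagonal_matrix_of d) (simp add: Q_def mult.commute)
  then have "A = Q ** diagonal_matrix_of d ** transpose Q"
    by (metis QQ matrix_mul_assoc matrix_mul_rid)
  then show ?thesis
  proof (rule that[OF Q])
    show "norm (column i Q) = 1" for i
      by (simp add: col q norm_eq_1)
    show "column i Q \<bullet> (A *v column i Q) = d i" for i
      by (simp only: col d inner_scaleR_right q) simp
  qed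
qed

section \<open>Determinant and trace of positive definite matrices\<close>

lemma det_orthogonal_conj:
  fixes D :: "real ^ 'n ^ 'n"
  assumes "orthogonal_matrix Q"
  shows "det (Q ** D ** transpose Q) = det D"
proof -
  have "det Q * det Q = 1"
    using det_orthogonal_matrix[OF assms] by auto
  then show ?thesis by (simp add: det_mul)
qed

lemma trace_orthogonal_conj:
  fixes D :: "real ^ 'n ^ 'n"
  assumes "orthogonal_matrix Q"
  shows "trace (Q ** D ** transpose Q) = trace D"
  using assms trace_mul_sym[of "Q ** D" "transpose Q"]
  by (simp add: matrix_mul_assoc orthogonal_matrix_def)

lemma pos_def_transpose: "pos_def A \<Longrightarrow> transpose A = A"
  by (simp add: pos_def_def symmetric_matrices_def)

lemma pos_semidef_transpose: "pos_semidef A \<Longrightarrow> transpose A = A"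
  by (simp add: pos_semidef_def symmetric_matrices_def)

text \<open>Determinant and trace are the product and the sum of the eigenvalues, all positive; the
  second claim sums ln x <= x - 1 over them.\<close>

lemma pos_def_det_pos_ln_le_trace:
  fixes A :: "real ^ 'n ^ 'n"
  assumes "pos_def A"
  shows "det A > 0" "ln (det A) \<le> trace A - CARD('n)"
proof -
  obtain Q d where Q: "orthogonal_matrix Q" "A = Q ** diagonal_matrix_of d ** transpose Q"
    and n: "\<And>i. norm (column i Q) = 1" "\<And>i. column i Q \<bullet> (A *v column i Q) = d i"
    using symmetric_matrix_diagonalization[OF pos_def_transpose[OF assms]] by metis
  have d: "d i > 0" for i
    using assms n[of i] unfolding pos_def_def by (metis norm_zero zero_neq_one)
  have det: "det A = prod d UNIV" and tr: "trace A = sum d UNIV"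
    using Q by (metis det_orthogonal_conj det_diagonal_matrix_of)
      (use Q in \<open>metis trace_orthogonal_conj trace_diagonal_matrix_of\<close>)
  show "det A > 0" by (simp add: det d prod_pos)
  have "ln (det A) = (\<Sum>i\<in>UNIV. ln (d i))"
    unfolding det by (intro ln_prod) (use d in \<open>simp_all add: less_imp_neq[THEN not_sym]\<close>)
  also have "\<dots> \<le> (\<Sum>i\<in>UNIV. d i - 1)"
    by (intro sum_mono ln_le_minus_one d)
  finally show "ln (det A) \<le> trace A - CARD('n)"
    by (simp add: tr sum_subtractf)
qed

text \<open>With A = Q D Q^T, the factor is Q times the entrywise square root of D.\<close>

lemma pos_def_factorization:
  fixes A :: "real ^ 'n ^ 'n"
  assumes "pos_def A"
  obtains L :: "real ^ 'n ^ 'n" where "A = L ** transpose L"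
proof -
  obtain Q d where Q: "orthogonal_matrix Q" "A = Q ** diagonal_matrix_of d ** transpose Q"
    and n: "\<And>i. norm (column i Q) = 1" "\<And>i. column i Q \<bullet> (A *v column i Q) = d i"
    using symmetric_matrix_diagonalization[OF pos_def_transpose[OF assms]] by metis
  have d: "d i > 0" for i
    using assms n[of i] unfolding pos_def_def by (metis norm_zero zero_neq_one)
  define S where "S = diagonal_matrix_of (\<lambda>i. sqrt (d i))"
  have "S ** S = diagonal_matrix_of d"
    using d unfolding S_def
    by (simp add: vec_eq_iff matrix_mult_diagonal_matrix_of)
      (simp add: diagonal_matrix_of_def less_imp_le)
  moreover have "transpose S = S"
    by (auto simp: S_def vec_eq_iff transpose_def diagonal_matrix_of_def)
  ultimately have "A = (Q ** S) ** transpose (Q ** S)"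
    using Q(2) by (metis matrix_mul_assoc matrix_transpose_mul)
  then show ?thesis by (rule that)
qed

section \<open>Congruences and the trace inequality for two matrices\<close>

lemma inner_congruence:
  fixes L B :: "real ^ 'n ^ 'n"
  shows "x \<bullet> ((transpose L ** B ** L) *v x) = (L *v x) \<bullet> (B *v (L *v x))"
  using dot_lmul_matrix[of "B *v (L *v x)" L x]
  by (simp add: matrix_vector_mul_assoc[symmetric] inner_commute)

lemma det_nonzero_mult_vec_eq_0:
  fixes A :: "real ^ 'n ^ 'n"
  assumes "det A \<noteq> 0" "A *v x = 0"
  shows "x = 0"
proof -
  obtain B where "B ** A = mat 1"
    using assms(1) invertible_left_inverse invertible_det_nz by blast
  then have "x = B *v (A *v x)" by (simp add: matrix_vector_mul_assoc)
  then show ?thesis by (simp add: assms(2))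
qed

lemma pos_semidef_congruence:
  fixes L B :: "real ^ 'n ^ 'n"
  shows
  "pos_semidef B \<Longrightarrow> pos_semidef (transpose L ** B ** L)"
  unfolding pos_semidef_def symmetric_matrices_def
  by (simp add: matrix_transpose_mul matrix_mul_assoc inner_congruence)

lemma pos_def_congruence:
  fixes L B :: "real ^ 'n ^ 'n"
  assumes B: "pos_def B" and L: "det L \<noteq> 0"
  shows "pos_def (transpose L ** B ** L)"
proof -
  have "L *v x \<noteq> 0" if "x \<noteq> 0" for x
    using det_nonzero_mult_vec_eq_0[OF L] that by blast
  then show ?thesis
    using B unfolding pos_def_def symmetric_matrices_def
    by (simp add: matrix_transpose_mul matrix_mul_assoc inner_congruence)
qed

lemma inner_axis_matrix: "axis i 1 \<bullet> (A *v axis i (1 :: real)) = A $ i $ i"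
  by (simp add: matrix_vector_mult_basis inner_axis' column_def)

lemma pos_semidef_diagonal_nonneg: "pos_semidef A \<Longrightarrow> A $ i $ i \<ge> 0"
  unfolding pos_semidef_def by (metis inner_axis_matrix)

lemma pos_def_diagonal_pos: "pos_def A \<Longrightarrow> A $ i $ i > 0"
  unfolding pos_def_def by (metis inner_axis_matrix axis_eq_0_iff zero_neq_one)

lemma pos_def_imp_pos_semidef: "pos_def A \<Longrightarrow> pos_semidef A"
  unfolding pos_def_def pos_semidef_def
  by (metis inner_zero_left less_imp_le order_refl)

lemma trace_congruence:
  fixes L B :: "real ^ 'n ^ 'n"
  shows "trace (transpose L ** B ** L) = trace (L ** transpose L ** B)"
  using trace_mul_sym[of "transpose L ** B" L] by (simp add: matrix_mul_assoc)

text \<open>The product \<open>A ** B\<close> may fail to be symmetric, but with A = L L^T it has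
  the same trace as the congruence L^T B L, whose diagonal is nonnegative.\<close>

lemma trace_mult_pos_def_nonneg:
  fixes A B :: "real ^ 'n ^ 'n"
  assumes "pos_def A" "pos_semidef B"
  shows "trace (A ** B) \<ge> 0"
proof -
  obtain L :: "real ^ 'n ^ 'n" where L: "A = L ** transpose L" using pos_def_factorization assms by metis
  have "trace (transpose L ** B ** L) \<ge> 0"
    unfolding trace_def
    by (intro sum_nonneg pos_semidef_diagonal_nonneg pos_semidef_congruence assms)
  then show ?thesis by (simp add: L trace_congruence)
qed

text \<open>The one-matrix bound is applied to L^T B L with A = L L^T: this is positive definite,
  has determinant det A det B and the trace of \<open>A ** B\<close>.\<close>

lemma ln_det_add_le_trace_mult:
  fixes A B :: "real ^ 'n ^ 'n"
  assumes "pos_def A" "pos_def B"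
  shows "ln (det A) + ln (det B) \<le> trace (A ** B) - CARD('n)"
proof -
  obtain L :: "real ^ 'n ^ 'n" where L: "A = L ** transpose L" using pos_def_factorization assms by metis
  have A: "det A > 0" and B: "det B > 0" using assms pos_def_det_pos_ln_le_trace by auto
  have "det L \<noteq> 0" using A by (auto simp: L det_mul)
  then have "pos_def (transpose L ** B ** L)" using pos_def_congruence assms by blast
  from pos_def_det_pos_ln_le_trace(2)[OF this]
  have "ln (det (transpose L ** B ** L)) \<le> trace (A ** B) - CARD('n)"
    by (simp add: trace_congruence L)
  moreover have "det (transpose L ** B ** L) = det A * det B"
    by (simp add: L det_mul)
  ultimately show ?thesis using A B by (simp add: ln_mult)
qed

lemma pos_semidef_kernel:
  assumes "pos_semidef A" "x \<bullet> (A *v x) = 0"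
  shows "A *v x = 0"
proof -
  have "(A *v x) \<bullet> (A *v x) = 0"
    using psd_on_subspace_inner_eq_0[OF pos_semidef_transpose[OF assms(1)] subspace_UNIV _ UNIV_I UNIV_I assms(2)]
      assms(1) unfolding pos_semidef_def by blast
  then show ?thesis by simp
qed

text \<open>A zero of a semidefinite form lies in the kernel, which is trivial here. Thus the closed
  condition \<open>pos_semidef\<close> can replace \<open>pos_def\<close> wherever the determinant
  is bounded away from 0.\<close>

lemma pos_semidef_det_nonzero_imp_pos_def:
  assumes "pos_semidef A" "det A \<noteq> 0"
  shows "pos_def A"
proof -
  have "x \<bullet> (A *v x) > 0" if "x \<noteq> 0" for x
  proof -
    have "A *v x \<noteq> 0"
      using det_nonzero_mult_vec_eq_0[OF assms(2)] that by blast
    then show ?thesis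
      using assms(1) pos_semidef_kernel[OF assms(1)] unfolding pos_semidef_def
      by (metis less_eq_real_def)
  qed
  then show ?thesis using assms(1) by (auto simp: pos_def_def pos_semidef_def)
qed

text \<open>The inverse P is symmetric because its transpose is also a left inverse of A;
  definiteness follows from P^T A P = P, a congruence of A.\<close>

lemma matrix_inv_pos_def:
  fixes A :: "real ^ 'n ^ 'n"
  assumes "pos_def A"
  shows "A ** matrix_inv A = mat 1" "matrix_inv A ** A = mat 1" "pos_def (matrix_inv A)"
proof -
  have "invertible A"
    using pos_def_det_pos_ln_le_trace(1)[OF assms] by (simp add: invertible_det_nz)
  then have "A ** matrix_inv A = mat 1 \<and> matrix_inv A ** A = mat 1"
    unfolding invertible_def matrix_inv_def by (rule someI_ex)
  then show 1: "A ** matrix_inv A = mat 1" "matrix_inv A ** A = mat 1" by auto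
  have "transpose (matrix_inv A) ** A = mat 1"
    using arg_cong[OF 1(1), of transpose] by (simp add: matrix_transpose_mul pos_def_transpose[OF assms])
  then have t: "transpose (matrix_inv A) = matrix_inv A"
    by (metis 1(1) matrix_mul_assoc matrix_mul_lid matrix_mul_rid)
  have "transpose (matrix_inv A) ** A ** matrix_inv A = matrix_inv A"
    by (simp add: t 1)
  moreover have "det (matrix_inv A) \<noteq> 0"
    using arg_cong[OF 1(1), of det] by (auto simp: det_mul)
  ultimately show "pos_def (matrix_inv A)"
    using pos_def_congruence[OF assms, of "matrix_inv A"] by simp
qed

section \<open>Diagonal matrices and Hadamard's inequality\<close>

lemma inner_diagonal_matrix_of:
  "x \<bullet> (diagonal_matrix_of d *v x) = (\<Sum>i\<in>UNIV. d i * (x $ i)\<^sup>2)"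
  by (simp add: inner_vec_def matrix_vector_mult_def diagonal_matrix_of_def power2_eq_square
      if_distrib if_distribR mult_ac cong: if_cong)

lemma diagonal_matrix_of_symmetric: "diagonal_matrix_of d \<in> symmetric_matrices"
  by (auto simp: symmetric_matrices_def vec_eq_iff transpose_def diagonal_matrix_of_def)

lemma pos_semidef_diagonal_matrix_of:
  assumes "\<And>i. d i \<ge> 0"
  shows "pos_semidef (diagonal_matrix_of d)"
  using assms
  by (simp add: pos_semidef_def diagonal_matrix_of_symmetric inner_diagonal_matrix_of sum_nonneg)

lemma pos_def_diagonal_matrix_of:
  assumes "\<And>i. d i > 0"
  shows "pos_def (diagonal_matrix_of d)"
proof -
  have "x \<bullet> (diagonal_matrix_of d *v x) > 0" if "x \<noteq> 0" for x
  proof -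
    obtain i where "x $ i \<noteq> 0" using \<open>x \<noteq> 0\<close> by (auto simp: vec_eq_iff)
    then have "d i * (x $ i)\<^sup>2 > 0" using assms by simp
    moreover have "d j * (x $ j)\<^sup>2 \<ge> 0" for j
      using assms[of j] by simp
    ultimately show ?thesis
      unfolding inner_diagonal_matrix_of by (intro sum_pos2[of UNIV i]) auto
  qed
  then show ?thesis
    by (simp add: pos_def_def diagonal_matrix_of_symmetric)
qed

lemma diag2_eq: "diag2 A = diagonal_matrix_of (\<lambda>i. A $ i $ i)"
  by (simp add: diag2_def diagonal_matrix_of_def vec_eq_iff)

text \<open>The trace inequality against the diagonal matrix with entries 1 / d i: its trace term is
  a sum of n ratios, each at most 1, and cancels n. Upper bounds \<open>d\<close> in place of the
  diagonal of \<open>B\<close> itself permit a comparison with the diagonal of another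
  matrix.\<close>

lemma hadamard_inequality_ln_det:
  fixes B :: "real ^ 'n ^ 'n"
  assumes "pos_def B" "\<And>i. d i > 0" "\<And>i. B $ i $ i \<le> d i"
  shows "ln (det B) \<le> ln (prod d UNIV)"
proof -
  let ?A = "diagonal_matrix_of (\<lambda>i. inverse (d i))"
  have "pos_def ?A" using assms by (intro pos_def_diagonal_matrix_of) simp
  from ln_det_add_le_trace_mult[OF this assms(1)]
  have "ln (det ?A) + ln (det B) \<le> (\<Sum>i\<in>UNIV. inverse (d i) * B $ i $ i) - CARD('n)"
    by (simp add: trace_def diagonal_matrix_of_mult)
  moreover have "(\<Sum>i\<in>UNIV. inverse (d i) * B $ i $ i) \<le> (\<Sum>i::'n\<in>UNIV. 1)"
    using assms by (intro sum_mono) (simp add: field_simps)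
  moreover have "ln (det ?A) = - ln (prod d UNIV)"
    by (simp add: det_diagonal_matrix_of ln_inverse prod_inversef[unfolded comp_def])
  ultimately show ?thesis by simp
qed

section \<open>Norm bounds, closedness and a uniform spectral bound\<close>

lemma pos_semidef_offdiagonal_le:
  fixes A :: "real ^ 'n ^ 'n"
  assumes "pos_semidef A"
  shows "2 * \<bar>A $ i $ j\<bar> \<le> A $ i $ i + A $ j $ j"
proof -
  have sym: "A $ j $ i = A $ i $ j"
    using pos_semidef_transpose[OF assms] by (metis transpose_def vec_lambda_beta)
  have ax: "axis i 1 \<bullet> (A *v axis j (1::real)) = A $ i $ j" for i j
    by (simp add: matrix_vector_mult_basis inner_axis' column_def)
  \<comment> \<open>The two signs of the test vector bound the off-diagonal entry from below and
    from above.\<close>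
  have "(axis i 1 + axis j 1) \<bullet> (A *v (axis i 1 + axis j (1::real))) \<ge> 0"
    "(axis i 1 - axis j 1) \<bullet> (A *v (axis i 1 - axis j (1::real))) \<ge> 0"
    using assms unfolding pos_semidef_def by blast+
  then show ?thesis
    by (simp add: inner_add_left inner_add_right inner_diff_left inner_diff_right ax sym
        matrix_vector_right_distrib matrix_vector_mult_diff_distrib)
qed

lemma norm_matrix_le_entries:
  fixes A :: "real ^ 'n ^ 'm" and c :: real
  assumes "\<And>i j. \<bar>A $ i $ j\<bar> \<le> c"
  shows "norm A \<le> CARD('m) * (CARD('n) * c)"
proof -
  have "norm A \<le> (\<Sum>i\<in>UNIV. norm (A $ i))"
    unfolding norm_vec_def[of A] by (rule L2_set_le_sum) simp
  also have "\<dots> \<le> (\<Sum>i::'m\<in>UNIV. \<Sum>j\<in>UNIV. \<bar>A $ i $ j\<bar>)"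
    by (intro sum_mono norm_le_l1_cart)
  also have "\<dots> \<le> (\<Sum>i::'m\<in>UNIV. \<Sum>j::'n\<in>UNIV. c)"
    by (intro sum_mono assms)
  finally show ?thesis by simp
qed

text \<open>Off-diagonal entries of a semidefinite matrix are dominated by diagonal ones, so bounds
  on the diagonal alone give boundedness in norm; the constant is crude, but only compactness
  arguments use it.\<close>

lemma pos_semidef_norm_le:
  fixes A :: "real ^ 'n ^ 'n" and c :: real
  assumes "pos_semidef A" "\<And>i. A $ i $ i \<le> c"
  shows "norm A \<le> CARD('n) * (CARD('n) * c)"
proof (rule norm_matrix_le_entries)
  fix i j
  show "\<bar>A $ i $ j\<bar> \<le> c"
    using pos_semidef_offdiagonal_le[OF assms(1), of i j] assms(2)[of i] assms(2)[of j] by simp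
qed

lemma continuous_on_det [continuous_intros]:
  fixes f :: "_ \<Rightarrow> real ^ 'n ^ 'n"
  shows "continuous_on S f \<Longrightarrow> continuous_on S (\<lambda>x. det (f x))"
  unfolding det_def by (intro continuous_intros)

lemma continuous_on_matrix_vector_mult [continuous_intros]:
  fixes f :: "_ \<Rightarrow> real ^ 'n ^ 'm"
  shows "continuous_on S f \<Longrightarrow> continuous_on S g \<Longrightarrow> continuous_on S (\<lambda>x. f x *v g x)"
  unfolding matrix_vector_mult_def by (intro continuous_intros)

lemma closed_symmetric_matrices: "closed (symmetric_matrices :: (real ^ 'n ^ 'n) set)"
proof -
  have "(symmetric_matrices :: (real ^ 'n ^ 'n) set) = {A. \<forall>i j. A $ j $ i = A $ i $ j}"
    by (auto simp: symmetric_matrices_def transpose_def vec_eq_iff)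
  moreover have "closed {A :: real ^ 'n ^ 'n. \<forall>i j. A $ j $ i = A $ i $ j}"
    by (intro closed_Collect_all closed_Collect_eq continuous_intros)
  ultimately show ?thesis by (rule ssubst)
qed

lemma closed_pos_semidef: "closed {A :: real ^ 'n ^ 'n. pos_semidef A}"
  using closed_symmetric_matrices unfolding pos_semidef_def
  by (intro closed_Collect_conj closed_Collect_all closed_Collect_le continuous_intros) simp_all

lemma closed_diagonal_matrices: "closed (diagonal_matrices :: (real ^ 'n ^ 'n) set)"
proof -
  have "closed {A :: real ^ 'n ^ 'n. i \<noteq> j \<longrightarrow> A $ i $ j = 0}" for i j
    by (cases "i = j") (auto intro!: closed_Collect_eq continuous_intros)
  then show ?thesis
    using closed_symmetric_matrices unfolding diagonal_matrices_def
    by (intro closed_Collect_conj closed_Collect_all) simp_all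
qed

lemma closed_hollow_matrices: "closed (hollow_matrices :: (real ^ 'n ^ 'n) set)"
  using closed_symmetric_matrices unfolding hollow_matrices_def
  by (intro closed_Collect_conj closed_Collect_all closed_Collect_eq continuous_intros) simp_all

text \<open>The bounds on diagonal and determinant cut out a compact set \<open>K\<close> of
  positive definite matrices, so the quadratic form has a positive minimum over \<open>K\<close>
  times the unit sphere. Compactness takes the place of an explicit eigenvalue estimate.\<close>

lemma pos_def_uniform_lower_bound:
  fixes d :: "'n::finite \<Rightarrow> real"
  assumes "c > 0"
  obtains \<beta> where "\<beta> > 0"
    and "\<And>Z :: real ^ 'n ^ 'n. pos_def Z \<Longrightarrow> (\<And>i. Z $ i $ i \<le> d i) \<Longrightarrow> det Z \<ge> c
      \<Longrightarrow> \<beta> *\<^sub>R mat 1 \<preceq> Z"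
proof -
  define K where "K = {Z :: real ^ 'n ^ 'n. pos_semidef Z \<and> (\<forall>i. Z $ i $ i \<le> d i) \<and> c \<le> det Z}"
  have K: "pos_def Z" if "Z \<in> K" for Z
    using that assms by (intro pos_semidef_det_nonzero_imp_pos_def) (auto simp: K_def)
  have "closed K"
    unfolding K_def
    by (intro closed_Collect_conj closed_Collect_all closed_Collect_le continuous_intros closed_pos_semidef)
  moreover have "bounded K"
    unfolding bounded_iff
  proof (intro exI ballI)
    fix Z assume Z: "Z \<in> K"
    have "Z $ i $ i \<le> Max (range d)" for i
      using Z Max_ge[of "range d" "d i"] unfolding K_def by (auto intro: order_trans)
    then show "norm Z \<le> CARD('n) * (CARD('n) * Max (range d))"
      using Z by (intro pos_semidef_norm_le) (simp_all add: K_def)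
  qed
  ultimately have "compact K" by (simp add: compact_eq_bounded_closed)
  then have cpt: "compact (K \<times> sphere (0 :: real ^ 'n) 1)"
    by (intro compact_Times compact_sphere)
  note result = that
  \<comment> \<open>Scaling extends a lower bound on unit vectors to all vectors.\<close>
  have low: thesis if b: "\<beta> > 0" "\<And>Z x. Z \<in> K \<Longrightarrow> norm x = 1 \<Longrightarrow> \<beta> \<le> x \<bullet> (Z *v x)" for \<beta>
  proof (rule result[OF b(1)])
    fix Z :: "real ^ 'n ^ 'n"
    assume Z: "pos_def Z" "\<And>i. Z $ i $ i \<le> d i" "det Z \<ge> c"
    then have ZK: "Z \<in> K" by (simp add: K_def pos_def_imp_pos_semidef)
    have "x \<bullet> ((Z - \<beta> *\<^sub>R mat 1) *v x) \<ge> 0" for x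
    proof (cases "x = 0")
      case False
      then have "\<beta> \<le> ((1 / norm x) *\<^sub>R x) \<bullet> (Z *v ((1 / norm x) *\<^sub>R x))"
        by (intro b(2) ZK) simp
      then have "\<beta> \<le> (x \<bullet> (Z *v x)) / (norm x)\<^sup>2"
        by (simp add: matrix_vector_mult_scaleR power2_eq_square)
      then show ?thesis
        using False
        by (simp add: matrix_vector_mult_diff_rdistrib scaleR_matrix_vector_assoc[symmetric]
            inner_diff_right field_simps power2_norm_eq_inner)
    qed simp
    moreover have "transpose (Z - \<beta> *\<^sub>R mat 1) = Z - \<beta> *\<^sub>R mat 1"
      using pos_def_transpose[OF Z(1)] by (auto simp: vec_eq_iff transpose_def mat_def)
    ultimately show "\<beta> *\<^sub>R mat 1 \<preceq> Z"
      by (simp add: loewner_le_def pos_semidef_def symmetric_matrices_def)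
  qed
  show thesis
  proof (cases "K \<times> sphere (0 :: real ^ 'n) 1 = {}")
    \<comment> \<open>\<open>K\<close> may be empty, when the bounds on the diagonal exclude
      determinants as large as c; any positive \<beta> then works.\<close>
    case True
    then show ?thesis by (intro low[of 1]) auto
  next
    case False
    have "continuous_on (K \<times> sphere (0 :: real ^ 'n) 1) (\<lambda>p. snd p \<bullet> (fst p *v snd p))"
      by (intro continuous_intros)
    from continuous_attains_inf[OF cpt False this]
    obtain Z0 x0 where z: "Z0 \<in> K" "norm x0 = 1"
      "\<forall>p\<in>K \<times> sphere 0 1. x0 \<bullet> (Z0 *v x0) \<le> snd p \<bullet> (fst p *v snd p)" by force
    have "x0 \<bullet> (Z0 *v x0) > 0" using K[OF z(1)] z(2) unfolding pos_def_def by (metis norm_zero zero_neq_one)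
    then show ?thesis by (rule low) (use z(3) in force)
  qed
qed

section \<open>The restricted feasible set: compactness and inclusion\<close>

lemma loewner_le_diagonal: "A \<preceq> B \<Longrightarrow> A $ i $ i \<le> B $ i $ i"
  unfolding loewner_le_def using pos_semidef_diagonal_nonneg[of "B - A" i] by simp

lemma compact_restricted_feasible:
  fixes \<Sigma> :: "real ^ 'n ^ 'n"
  assumes "\<epsilon> > 0"
  shows "compact (restricted_feasible \<Sigma> \<epsilon> M \<rho> \<alpha> \<beta>)"
proof -
  define N where "N = CARD('n) * (CARD('n) * \<alpha>)"
  \<comment> \<open>\<Theta> is the sum of \<Theta> - \<Gamma> - \<rho> I, \<rho> I and \<Gamma>;
    the first summand is semidefinite with diagonal at most 1 - \<rho>.\<close>
  define N' where "N' = CARD('n) * (CARD('n) * (1 - \<rho>)) + norm (\<rho> *\<^sub>R mat 1 :: real ^ 'n ^ 'n) + N"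
  define B :: "(real \<times> (real ^ 'n ^ 'n) \<times> (real ^ 'n ^ 'n)) set"
    where "B = {\<epsilon>..M} \<times> cball 0 N \<times> cball 0 N'"
  have B: "compact B" unfolding B_def by (intro compact_Times compact_Icc compact_cball)
  have sub: "restricted_feasible \<Sigma> \<epsilon> M \<rho> \<alpha> \<beta> \<subseteq> B"
  proof (clarsimp simp: restricted_feasible_def B_def)
    fix l and \<Gamma> \<Theta> :: "real ^ 'n ^ 'n"
    assume a: "\<rho> *\<^sub>R mat 1 \<preceq> \<Theta> - \<Gamma>" "\<Theta> - \<Gamma> \<preceq> mat 1" "0 \<preceq> \<Gamma>" "\<Gamma> \<preceq> \<alpha> *\<^sub>R mat 1"
    have 1: "norm \<Gamma> \<le> N" unfolding N_def
      using a(3) loewner_le_diagonal[OF a(4)]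
      by (intro pos_semidef_norm_le) (simp_all add: loewner_le_def mat_def)
    have "norm (\<Theta> - \<Gamma> - \<rho> *\<^sub>R mat 1) \<le> CARD('n) * (CARD('n) * (1 - \<rho>))"
      using a(1) loewner_le_diagonal[OF a(2)]
      by (intro pos_semidef_norm_le) (simp_all add: loewner_le_def mat_def)
    moreover have "norm \<Theta> \<le> norm (\<Theta> - \<Gamma> - \<rho> *\<^sub>R mat 1) + norm (\<rho> *\<^sub>R mat 1 :: real ^ 'n ^ 'n) + norm \<Gamma>"
      using norm_triangle_ineq[of "\<Theta> - \<Gamma> - \<rho> *\<^sub>R mat 1 + \<rho> *\<^sub>R mat 1" \<Gamma>]
        norm_triangle_ineq[of "\<Theta> - \<Gamma> - \<rho> *\<^sub>R mat 1" "\<rho> *\<^sub>R mat 1"] by simp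
    ultimately show "norm \<Gamma> \<le> N \<and> norm \<Theta> \<le> N'"
      using 1 unfolding N'_def by linarith
  qed
  let ?f = "\<lambda>p :: real \<times> (real ^ 'n ^ 'n) \<times> (real ^ 'n ^ 'n).
    matrix_inv \<Sigma> + inverse (fst p) *\<^sub>R (snd (snd p) - fst (snd p)) - \<beta> *\<^sub>R mat 1"
  let ?C = "{p :: real \<times> (real ^ 'n ^ 'n) \<times> (real ^ 'n ^ 'n).
      pos_semidef (snd (snd p) - fst (snd p) - \<rho> *\<^sub>R mat 1)
    \<and> pos_semidef (mat 1 - (snd (snd p) - fst (snd p)))
    \<and> pos_semidef (fst (snd p) - 0) \<and> pos_semidef (\<alpha> *\<^sub>R mat 1 - fst (snd p))
    \<and> fst (snd p) \<in> diagonal_matrices \<and> snd (snd p) \<in> hollow_matrices}"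
  have vimage: "closed {p. g p \<in> S}" if "closed S" "continuous_on UNIV g"
    for g :: "real \<times> (real ^ 'n ^ 'n) \<times> (real ^ 'n ^ 'n) \<Rightarrow> real ^ 'n ^ 'n" and S
    using that by (simp add: continuous_on_closed_vimage vimage_def)
  have psd: "closed {p. pos_semidef (g p)}" if "continuous_on UNIV g"
    for g :: "real \<times> (real ^ 'n ^ 'n) \<times> (real ^ 'n ^ 'n) \<Rightarrow> real ^ 'n ^ 'n"
    using vimage[OF closed_pos_semidef that] by simp
  have "restricted_feasible \<Sigma> \<epsilon> M \<rho> \<alpha> \<beta> = B \<inter> restricted_feasible \<Sigma> \<epsilon> M \<rho> \<alpha> \<beta>"
    using sub by blast
  also have "\<dots> = (B \<inter> ?f -` {A. pos_semidef A}) \<inter> ?C"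
    by (auto simp: restricted_feasible_def B_def loewner_le_def)
  finally have eq: "restricted_feasible \<Sigma> \<epsilon> M \<rho> \<alpha> \<beta> = \<dots>" .
  \<comment> \<open>\<open>?f\<close> contains \<open>inverse l\<close>, which is continuous on
    \<open>B\<close> because l >= \<epsilon> > 0 there. This constraint is therefore a preimage
    relative to \<open>B\<close>, while those in \<open>?C\<close> are closed in the whole
    space.\<close>
  have "closed (B \<inter> ?f -` {A. pos_semidef A})"
    using assms by (intro continuous_closed_preimage closed_pos_semidef compact_imp_closed B continuous_intros)
      (auto simp: B_def)
  moreover have "closed ?C"
    by (intro closed_Collect_conj psd vimage closed_diagonal_matrices closed_hollow_matrices continuous_intros)
  ultimately have "closed (restricted_feasible \<Sigma> \<epsilon> M \<rho> \<alpha> \<beta>)"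
    unfolding eq by (rule closed_Int)
  then have "compact (B \<inter> restricted_feasible \<Sigma> \<epsilon> M \<rho> \<alpha> \<beta>)"
    by (rule compact_Int_closed[OF B])
  with sub show ?thesis by (simp add: Int_absorb1)
qed

lemma transpose_diff_scaleR_mat:
  fixes A :: "real ^ 'n ^ 'n"
  shows "transpose (A - c *\<^sub>R mat 1) = transpose A - c *\<^sub>R mat 1"
  by (auto simp: vec_eq_iff transpose_def mat_def)

text \<open>The bound by \<beta> I with \<beta> > 0 gives strict definiteness, and
  \<open>ofd\<close> fixes hollow matrices, so the constraints of both sets concern the same
  difference.\<close>

lemma restricted_feasible_subset:
  fixes \<Sigma> :: "real ^ 'n ^ 'n"
  assumes "\<epsilon> > 0" "\<beta> > 0"
  shows "restricted_feasible \<Sigma> \<epsilon> M \<rho> \<alpha> \<beta> \<subseteq> feasible \<Sigma>"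
proof (clarsimp simp: restricted_feasible_def feasible_def)
  fix l and \<Gamma> \<Theta> :: "real ^ 'n ^ 'n"
  assume a: "\<epsilon> \<le> l" "\<Theta> - \<Gamma> \<preceq> mat 1" "0 \<preceq> \<Gamma>" "\<Gamma> \<in> diagonal_matrices" "\<Theta> \<in> hollow_matrices"
    and b: "\<beta> *\<^sub>R mat 1 \<preceq> matrix_inv \<Sigma> + inverse l *\<^sub>R (\<Theta> - \<Gamma>)" (is "_ \<preceq> ?Z")
  have ofd: "ofd \<Theta> = \<Theta>"
    using a(5) by (auto simp: ofd_def diag2_def hollow_matrices_def vec_eq_iff)
  have psd: "pos_semidef (?Z - \<beta> *\<^sub>R mat 1)" using b by (simp add: loewner_le_def)
  have "x \<bullet> (?Z *v x) > 0" if "x \<noteq> 0" for x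
  proof -
    have "x \<bullet> ((?Z - \<beta> *\<^sub>R mat 1) *v x) \<ge> 0" using psd by (simp only: pos_semidef_def)
    then have "x \<bullet> (?Z *v x) \<ge> \<beta> * (x \<bullet> x)"
      by (simp add: matrix_vector_mult_diff_rdistrib scaleR_matrix_vector_assoc[symmetric] inner_diff_right)
    moreover have "\<beta> * (x \<bullet> x) > 0" using assms(2) that by simp
    ultimately show ?thesis by linarith
  qed
  moreover have "transpose ?Z = ?Z"
    using pos_semidef_transpose[OF psd] unfolding transpose_diff_scaleR_mat by (metis diff_add_cancel)
  ultimately have "pos_def ?Z" by (simp add: pos_def_def symmetric_matrices_def del: inverse_eq_divide)
  with a assms show "\<Gamma> \<in> symmetric_matrices \<and> \<Theta> \<in> symmetric_matrices \<and> 0 < l \<and>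
     pos_semidef (mat 1 + \<Gamma> - ofd \<Theta>) \<and> pos_semidef \<Gamma> \<and>
     pos_def (matrix_inv \<Sigma> + inverse l *\<^sub>R (ofd \<Theta> - \<Gamma>))"
    by (auto simp: ofd loewner_le_def diagonal_matrices_def hollow_matrices_def algebra_simps)
qed

section \<open>The objective: continuity and lower bounds\<close>

lemma continuous_on_J_dual:
  fixes \<Sigma> :: "real ^ 'n ^ 'n"
  shows "continuous_on (feasible \<Sigma>) (J_dual \<Sigma> \<delta>)"
proof -
  have ofd: "ofd \<Theta> = (\<chi> i j. if i = j then 0 else \<Theta> $ i $ j)" for \<Theta> :: "real ^ 'n ^ 'n"
    by (simp add: ofd_def diag2_def vec_eq_iff)
  have entry: "continuous_on S (\<lambda>p. if i = j then 0 else g p $ i $ j)" if "continuous_on S g"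
    for g :: "real \<times> (real ^ 'n ^ 'n) \<times> (real ^ 'n ^ 'n) \<Rightarrow> real ^ 'n ^ 'n" and S i j
    using that by (cases "i = j") (auto intro: continuous_intros)
  have c: "continuous_on (feasible \<Sigma>) (\<lambda>p. ofd (snd (snd p)))"
    unfolding ofd by (intro entry continuous_intros)
  \<comment> \<open>Positivity keeps \<open>inverse\<close> and \<open>ln\<close> away from 0, where
    their default values would break continuity.\<close>
  have "l > 0" "det (matrix_inv \<Sigma> + inverse l *\<^sub>R (ofd \<Theta> - \<Gamma>)) > 0"
    if "(l, \<Gamma>, \<Theta>) \<in> feasible \<Sigma>" for l \<Gamma> \<Theta>
    using that pos_def_det_pos_ln_le_trace(1) by (auto simp: feasible_def)
  then show ?thesis
    unfolding J_dual_def case_prod_beta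
    by (intro continuous_intros c) force+
qed

text \<open>Two complementary estimates: for \<delta> below \<open>delta_max\<close>, the first
  bounds l from below on a negative sublevel set; for \<delta> > 0, the second bounds it from above.
  The diagonal of \<open>Z\<close> only loses \<Gamma>_ii / l, because \<open>ofd\<close> has zero
  diagonal.\<close>

lemma feasible_dual_bounds:
  fixes \<Sigma> :: "real ^ 'n ^ 'n"
  assumes S: "pos_def \<Sigma>" and p: "(l, \<Gamma>, \<Theta>) \<in> feasible \<Sigma>"
  defines "Z \<equiv> matrix_inv \<Sigma> + inverse l *\<^sub>R (ofd \<Theta> - \<Gamma>)"
  shows "Z $ i $ i \<le> matrix_inv \<Sigma> $ i $ i"
    and "l * (\<delta> - delta_max \<Sigma>) \<le> J_dual \<Sigma> \<delta> (l, \<Gamma>, \<Theta>)"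
    and "l * \<delta> - trace \<Sigma> \<le> J_dual \<Sigma> \<delta> (l, \<Gamma>, \<Theta>)"
proof -
  let ?P = "matrix_inv \<Sigma>" and ?X = "ofd \<Theta> - \<Gamma>"
  have l: "l > 0" and X: "pos_semidef (mat 1 + \<Gamma> - ofd \<Theta>)" and G: "pos_semidef \<Gamma>" and Z: "pos_def Z"
    using p by (auto simp: feasible_def Z_def)
  note P = matrix_inv_pos_def[OF S]
  have dS: "det \<Sigma> > 0" using S pos_def_det_pos_ln_le_trace by blast
  show Zd: "Z $ i $ i \<le> ?P $ i $ i" for i
    using pos_semidef_diagonal_nonneg[OF G, of i] l by (simp add: Z_def ofd_def diag2_def)
  have Pp: "?P $ i $ i > 0" for i by (rule pos_def_diagonal_pos[OF P(3)])
  have "delta_max \<Sigma> = ln ((\<Prod>i\<in>UNIV. ?P $ i $ i) * det \<Sigma>)"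
    by (simp add: delta_max_def det_mul diag2_eq det_diagonal_matrix_of)
  also have "\<dots> = ln (\<Prod>i\<in>UNIV. ?P $ i $ i) + ln (det \<Sigma>)"
    using dS Pp by (intro ln_mult_pos prod_pos) auto
  finally have dm: "delta_max \<Sigma> = ln (\<Prod>i\<in>UNIV. ?P $ i $ i) + ln (det \<Sigma>)" .
  have J: "J_dual \<Sigma> \<delta> (l, \<Gamma>, \<Theta>) = l * (- ln (det Z) - ln (det \<Sigma>) + \<delta>)"
    by (simp add: J_dual_def Z_def)
  have "ln (det Z) \<le> ln (\<Prod>i\<in>UNIV. ?P $ i $ i)"
    by (intro hadamard_inequality_ln_det Z Pp Zd)
  then show "l * (\<delta> - delta_max \<Sigma>) \<le> J_dual \<Sigma> \<delta> (l, \<Gamma>, \<Theta>)"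
    unfolding J using l dm by (intro mult_left_mono) auto
  \<comment> \<open>The constraint I - X >= 0 is paired with \<Sigma>. Since X = l (Z - P) and
    \<Sigma> P = I, this bounds l (trace (\<Sigma> Z) - n) by trace \<Sigma>.\<close>
  have "trace (\<Sigma> ** (mat 1 + \<Gamma> - ofd \<Theta>)) \<ge> 0"
    by (rule trace_mult_pos_def_nonneg[OF S X])
  moreover have "\<Sigma> ** (mat 1 + \<Gamma> - ofd \<Theta>) = \<Sigma> - l *\<^sub>R (\<Sigma> ** Z - mat 1)"
  proof -
    have "mat 1 + \<Gamma> - ofd \<Theta> = mat 1 - l *\<^sub>R (Z - ?P)"
      using l by (simp add: Z_def)
    moreover have "\<Sigma> ** (mat 1 - l *\<^sub>R (Z - ?P)) = \<Sigma> ** mat 1 - l *\<^sub>R (\<Sigma> ** Z - \<Sigma> ** ?P)"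
      by (simp add: vec_eq_iff matrix_matrix_mult_def sum.distrib sum_subtractf sum_distrib_left algebra_simps
          del: matrix_mul_rid)
    ultimately show ?thesis by (simp only: P matrix_mul_rid)
  qed
  ultimately have "l * (trace (\<Sigma> ** Z) - CARD('n)) \<le> trace \<Sigma>"
    by (simp add: trace_def sum_subtractf mat_def flip: sum_distrib_left)
  moreover have "l * (ln (det \<Sigma>) + ln (det Z)) \<le> l * (trace (\<Sigma> ** Z) - CARD('n))"
    using l ln_det_add_le_trace_mult[OF S Z] by (intro mult_left_mono) auto
  ultimately show "l * \<delta> - trace \<Sigma> \<le> J_dual \<Sigma> \<delta> (l, \<Gamma>, \<Theta>)"
    unfolding J by (simp add: algebra_simps)
qed

section \<open>The reference point and the reduction of its sublevel set\<close>

lemma ofd_eq: "ofd A $ i $ j = (if i = j then 0 else A $ i $ j)"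
  by (simp add: ofd_def diag2_def)

lemma pos_semidef_add:
  "pos_semidef A \<Longrightarrow> pos_semidef B \<Longrightarrow> pos_semidef (A + B)"
  by (simp add: pos_semidef_def symmetric_matrices_def vec_eq_iff transpose_def
      matrix_vector_mult_add_rdistrib inner_add_right)

lemma pos_semidef_scaleR: "pos_semidef A \<Longrightarrow> 0 \<le> c \<Longrightarrow> pos_semidef (c *\<^sub>R A)"
  by (simp add: pos_semidef_def symmetric_matrices_def transpose_scalar
      scaleR_matrix_vector_assoc[symmetric])

text \<open>Cauchy-Schwarz bounds the quadratic form by the operator norm times the squared length
  of x.\<close>

lemma loewner_le_onorm:
  assumes "transpose A = A" "onorm ((*v) A) \<le> t"
  shows "A \<preceq> t *\<^sub>R mat 1"
proof -
  have "x \<bullet> ((t *\<^sub>R mat 1 - A) *v x) \<ge> 0" for x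
  proof -
    have "x \<bullet> (A *v x) \<le> norm x * norm (A *v x)" by (rule norm_cauchy_schwarz)
    also have "\<dots> \<le> norm x * (onorm ((*v) A) * norm x)"
      by (intro mult_left_mono onorm matrix_vector_mul_bounded_linear) simp
    also have "\<dots> \<le> norm x * (t * norm x)"
      using assms(2) by (intro mult_left_mono mult_right_mono) auto
    also have "\<dots> = t * (x \<bullet> x)"
      by (simp add: power2_norm_eq_inner[symmetric] power2_eq_square)
    finally show ?thesis
      by (simp add: matrix_vector_mult_diff_rdistrib scaleR_matrix_vector_assoc[symmetric] inner_diff_right)
  qed
  then show ?thesis
    using assms(1)
    by (simp add: loewner_le_def pos_semidef_def symmetric_matrices_def vec_eq_iff transpose_def mat_def)
qed

text \<open>At this point the argument of the logarithm is \<open>diag2 (matrix_inv \<Sigma>)\<close>, the equality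
  case of Hadamard's inequality; this is where the threshold \<open>delta_max\<close> comes from.\<close>

lemma feasible_reference_point:
  fixes \<Sigma> :: "real ^ 'n ^ 'n"
  assumes S: "pos_def \<Sigma>" and t: "onorm ((*v) (matrix_inv \<Sigma>)) < t"
  defines "p \<equiv> (inverse t, 0, - (inverse t *\<^sub>R matrix_inv \<Sigma>))"
  shows "t > 0" "p \<in> feasible \<Sigma>" "J_dual \<Sigma> \<delta> p = inverse t * (\<delta> - delta_max \<Sigma>)"
proof -
  let ?P = "matrix_inv \<Sigma>"
  note P = matrix_inv_pos_def[OF S]
  have Pp: "?P $ i $ i > 0" for i by (rule pos_def_diagonal_pos[OF P(3)])
  have "?P \<preceq> onorm ((*v) ?P) *\<^sub>R mat 1"
    by (intro loewner_le_onorm pos_def_transpose P order_refl)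
  from loewner_le_diagonal[OF this] have Pt: "?P $ i $ i < t" for i
    using le_less_trans[OF _ t] by (simp add: mat_def)
  show t0: "t > 0" using Pp Pt less_trans by blast
  \<comment> \<open>With l = 1 / t, \<Gamma> = 0 and \<Theta> = - P / t, the scaled
    \<open>ofd \<Theta>\<close> cancels exactly the off-diagonal part of P.\<close>
  have Z: "?P + inverse (inverse t) *\<^sub>R (ofd (- (inverse t *\<^sub>R ?P)) - 0) = diag2 ?P"
    using t0 by (simp add: vec_eq_iff ofd_eq diag2_def)
  have D: "pos_def (diag2 ?P)" unfolding diag2_eq by (rule pos_def_diagonal_matrix_of[OF Pp])
  \<comment> \<open>I + ofd P / t splits into I - diag2 P / t and P / t; the first is semidefinite
    because t exceeds every P_ii.\<close>
  have "mat 1 + 0 - ofd (- (inverse t *\<^sub>R ?P))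
      = diagonal_matrix_of (\<lambda>i. 1 - inverse t * ?P $ i $ i) + inverse t *\<^sub>R ?P"
    by (simp add: vec_eq_iff ofd_eq diagonal_matrix_of_def mat_def)
  moreover have "pos_semidef \<dots>"
    using t0 Pt by (intro pos_semidef_add pos_semidef_diagonal_matrix_of pos_semidef_scaleR
        pos_def_imp_pos_semidef P) (auto simp: field_simps less_imp_le)
  ultimately have X: "pos_semidef (mat 1 + 0 - ofd (- (inverse t *\<^sub>R ?P)))" by simp
  have "transpose (- (inverse t *\<^sub>R ?P)) = - (inverse t *\<^sub>R ?P)"
    using pos_def_transpose[OF P(3)] by (simp add: vec_eq_iff transpose_def)
  moreover have "pos_semidef (0 :: real ^ 'n ^ 'n)"
    by (simp add: pos_semidef_def symmetric_matrices_def vec_eq_iff transpose_def)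
  ultimately show "p \<in> feasible \<Sigma>"
    unfolding feasible_def p_def prod.case mem_Collect_eq Z
    using D X t0 by (simp add: symmetric_matrices_def pos_semidef_def)
  have "delta_max \<Sigma> = ln (det (diag2 ?P)) + ln (det \<Sigma>)"
    unfolding delta_max_def det_mul
    using D S pos_def_det_pos_ln_le_trace(1) by (intro ln_mult_pos) auto
  then show "J_dual \<Sigma> \<delta> p = inverse t * (\<delta> - delta_max \<Sigma>)"
    unfolding J_dual_def p_def prod.case Z by simp
qed

text \<open>The new point has the same difference \<open>ofd \<Theta> - \<Gamma>\<close>, which is all that the objective and the
  remaining constraints see.\<close>

lemma feasible_sublevel_reduction:
  fixes \<Sigma> :: "real ^ 'n ^ 'n"
  assumes S: "pos_def \<Sigma>" and \<delta>: "0 < \<delta>" "\<delta> < delta_max \<Sigma>"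
    and t: "onorm ((*v) (matrix_inv \<Sigma>)) < t"
    and M: "trace \<Sigma> / \<delta> \<le> M"
    and \<beta>: "\<And>Z :: real ^ 'n ^ 'n. pos_def Z \<Longrightarrow> (\<And>i. Z $ i $ i \<le> matrix_inv \<Sigma> $ i $ i)
      \<Longrightarrow> det Z \<ge> exp \<delta> / det \<Sigma> \<Longrightarrow> \<beta> *\<^sub>R mat 1 \<preceq> Z"
    and p: "(l, \<Gamma>, \<Theta>) \<in> feasible \<Sigma>"
    and J: "J_dual \<Sigma> \<delta> (l, \<Gamma>, \<Theta>) \<le> inverse t * (\<delta> - delta_max \<Sigma>)"
  shows "(l, diag2 \<Gamma>, ofd \<Theta> - ofd \<Gamma>) \<in> restricted_feasible \<Sigma> (inverse t) M (- (M * t)) (M * t) \<beta>"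
    and "J_dual \<Sigma> \<delta> (l, diag2 \<Gamma>, ofd \<Theta> - ofd \<Gamma>) = J_dual \<Sigma> \<delta> (l, \<Gamma>, \<Theta>)"
proof -
  let ?P = "matrix_inv \<Sigma>"
  define X where "X = ofd \<Theta> - \<Gamma>"
  define Z where "Z = ?P + inverse l *\<^sub>R X"
  note P = matrix_inv_pos_def[OF S]
  note t0 = feasible_reference_point(1)[OF S t]
  have f: "l > 0" "pos_semidef (mat 1 + \<Gamma> - ofd \<Theta>)" "pos_semidef \<Gamma>" "pos_def Z"
    "transpose \<Gamma> = \<Gamma>" "transpose \<Theta> = \<Theta>"
    using p by (auto simp: feasible_def Z_def X_def symmetric_matrices_def)
  \<comment> \<open>The off-diagonal part of \<Gamma> is moved into \<Theta>, leaving X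
    unchanged.\<close>
  have XX: "ofd \<Theta> - ofd \<Gamma> - diag2 \<Gamma> = X"
    by (simp add: X_def ofd_def)
  have "ofd (ofd \<Theta> - ofd \<Gamma>) = ofd \<Theta> - ofd \<Gamma>"
    by (simp add: vec_eq_iff ofd_eq)
  then show "J_dual \<Sigma> \<delta> (l, diag2 \<Gamma>, ofd \<Theta> - ofd \<Gamma>) = J_dual \<Sigma> \<delta> (l, \<Gamma>, \<Theta>)"
    by (simp add: J_dual_def XX) (simp add: X_def)
  note bounds = feasible_dual_bounds[OF S p, folded X_def, folded Z_def]
  have neg: "inverse t * (\<delta> - delta_max \<Sigma>) < 0"
    using t0 \<delta> by (simp add: mult_pos_neg)
  \<comment> \<open>Cancelling the negative factor \<delta> - \<open>delta_max\<close> reverses the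
    inequality and gives the lower bound on l.\<close>
  have "l * (\<delta> - delta_max \<Sigma>) \<le> inverse t * (\<delta> - delta_max \<Sigma>)"
    using bounds(2) J by (rule order_trans)
  then have l1: "inverse t \<le> l" using \<delta> by (simp add: mult_le_cancel_right)
  have "l * \<delta> \<le> trace \<Sigma>" using bounds(3)[of \<delta>] J neg by linarith
  then have "l \<le> trace \<Sigma> / \<delta>" using \<delta> by (simp add: field_simps)
  then have l2: "l \<le> M" using M by linarith
  have pos: "det Z > 0" "det \<Sigma> > 0" using pos_def_det_pos_ln_le_trace(1) f S by auto
  have "l * (- ln (det Z) - ln (det \<Sigma>) + \<delta>) < 0"
    using J neg by (simp add: J_dual_def Z_def X_def)
  then have "\<delta> < ln (det Z) + ln (det \<Sigma>)"
    using f(1) by (simp add: mult_less_0_iff)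
  also have "\<dots> = ln (det Z * det \<Sigma>)" using pos by (simp add: ln_mult_pos)
  finally have "exp \<delta> \<le> det Z * det \<Sigma>"
    using pos by (metis exp_le_cancel_iff exp_ln less_imp_le mult_pos_pos)
  then have "det Z \<ge> exp \<delta> / det \<Sigma>" using pos by (simp add: field_simps)
  then have Zb: "\<beta> *\<^sub>R mat 1 \<preceq> Z" by (intro \<beta> f bounds)
  have tP: "pos_semidef (t *\<^sub>R mat 1 - ?P)"
    using loewner_le_onorm[OF pos_def_transpose[OF P(3)], of t] t by (simp add: loewner_le_def)
  \<comment> \<open>Since X = l (Z - P), X + M t I is a sum of three semidefinite terms, using P <=
    t I and l <= M. This is the origin of \<rho> = - M t.\<close>
  have "X - (- (M * t)) *\<^sub>R mat 1 = l *\<^sub>R Z + (l *\<^sub>R (t *\<^sub>R mat 1 - ?P) + ((M - l) * t) *\<^sub>R mat 1)"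
    using f(1) by (simp add: Z_def algebra_simps)
  moreover have "pos_semidef (mat 1 :: real ^ 'n ^ 'n)"
    by (simp add: pos_semidef_def symmetric_matrices_def)
  ultimately have Xl: "- (M * t) *\<^sub>R mat 1 \<preceq> X"
    using f(1) l2 t0 tP pos_def_imp_pos_semidef[OF f(4)] unfolding loewner_le_def
    by (auto intro!: pos_semidef_add pos_semidef_scaleR)
  have Xu: "X \<preceq> mat 1"
    using f(2) by (simp add: loewner_le_def X_def algebra_simps)
  have G0: "0 \<preceq> diag2 \<Gamma>"
    using pos_semidef_diagonal_nonneg[OF f(3)]
    by (simp add: loewner_le_def diag2_eq pos_semidef_diagonal_matrix_of)
  \<comment> \<open>The diagonal of X is that of - \<Gamma>, so the lower bound on X doubles as the
    upper bound \<alpha> = M t on the diagonal of \<Gamma>.\<close>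
  have "\<Gamma> $ i $ i \<le> M * t" for i
    using loewner_le_diagonal[OF Xl, of i] by (simp add: X_def ofd_eq mat_def)
  then have "pos_semidef (diagonal_matrix_of (\<lambda>i. M * t - \<Gamma> $ i $ i))"
    by (intro pos_semidef_diagonal_matrix_of) simp
  moreover have "(M * t) *\<^sub>R mat 1 - diag2 \<Gamma> = diagonal_matrix_of (\<lambda>i. M * t - \<Gamma> $ i $ i)"
    by (simp add: vec_eq_iff diag2_def diagonal_matrix_of_def mat_def)
  ultimately have Gu: "diag2 \<Gamma> \<preceq> (M * t) *\<^sub>R mat 1"
    by (simp add: loewner_le_def)
  have "diag2 \<Gamma> \<in> diagonal_matrices"
    by (simp add: diagonal_matrices_def diag2_eq diagonal_matrix_of_symmetric) (simp add: diagonal_matrix_of_def)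
  moreover have "ofd \<Theta> - ofd \<Gamma> \<in> hollow_matrices"
    using f(5,6) by (simp add: hollow_matrices_def symmetric_matrices_def vec_eq_iff transpose_def ofd_eq)
  ultimately show "(l, diag2 \<Gamma>, ofd \<Theta> - ofd \<Gamma>) \<in> restricted_feasible \<Sigma> (inverse t) M (- (M * t)) (M * t) \<beta>"
    unfolding restricted_feasible_def prod.case mem_Collect_eq XX Z_def[symmetric]
    using l1 l2 Xl Xu G0 Gu Zb by simp
qed

section \<open>Attainment of the common minimum\<close>

theorem theoremV1:
  fixes \<Sigma> :: "real ^ 'n ^ 'n" and \<delta> :: real
  assumes "\<Sigma> \<in> symmetric_matrices" and "pos_def \<Sigma>"
    and "0 < \<delta>" and "\<delta> < delta_max \<Sigma>"
  shows "\<exists>\<epsilon> M \<rho> \<alpha> \<beta> :: real.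
    0 < \<epsilon> \<and> \<epsilon> \<le> M \<and> 0 < \<alpha> \<and> 0 < \<beta> \<and>
    restricted_feasible \<Sigma> \<epsilon> M \<rho> \<alpha> \<beta> \<subseteq> feasible \<Sigma> \<and>
    (INF p\<in>feasible \<Sigma>. J_dual \<Sigma> \<delta> p)
      = (INF p\<in>restricted_feasible \<Sigma> \<epsilon> M \<rho> \<alpha> \<beta>. J_dual \<Sigma> \<delta> p) \<and>
    (\<exists>p. is_arg_min (J_dual \<Sigma> \<delta>) (\<lambda>q. q \<in> feasible \<Sigma>) p) \<and>
    (\<exists>p. is_arg_min (J_dual \<Sigma> \<delta>)
           (\<lambda>q. q \<in> restricted_feasible \<Sigma> \<epsilon> M \<rho> \<alpha> \<beta>) p)"
proof -
  \<comment> \<open>Adding 1 makes t strictly larger than the operator norm.\<close>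
  define t where "t = onorm ((*v) (matrix_inv \<Sigma>)) + 1"
  \<comment> \<open>The maximum makes \<epsilon> = 1 / t at most M by construction.\<close>
  define M where "M = max (inverse t) (trace \<Sigma> / \<delta>)"
  define J0 where "J0 = inverse t * (\<delta> - delta_max \<Sigma>)"
  have t: "onorm ((*v) (matrix_inv \<Sigma>)) < t" by (simp add: t_def)
  obtain p0 where p0: "p0 \<in> feasible \<Sigma>" "J_dual \<Sigma> \<delta> p0 = J0" and t0: "t > 0"
    using feasible_reference_point[OF assms(2) t] by (auto simp: J0_def)
  have "exp \<delta> / det \<Sigma> > 0"
    using pos_def_det_pos_ln_le_trace(1)[OF assms(2)] by simp
  then obtain \<beta> where \<beta>: "\<beta> > 0" "\<And>Z :: real ^ 'n ^ 'n. pos_def Z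
      \<Longrightarrow> (\<And>i. Z $ i $ i \<le> matrix_inv \<Sigma> $ i $ i) \<Longrightarrow> det Z \<ge> exp \<delta> / det \<Sigma> \<Longrightarrow> \<beta> *\<^sub>R mat 1 \<preceq> Z"
    using pos_def_uniform_lower_bound[of "exp \<delta> / det \<Sigma>" "\<lambda>i. matrix_inv \<Sigma> $ i $ i"] by blast
  define R where "R = restricted_feasible \<Sigma> (inverse t) M (- (M * t)) (M * t) \<beta>"
  have red: "\<exists>p'\<in>R. J_dual \<Sigma> \<delta> p' = J_dual \<Sigma> \<delta> p" if "p \<in> feasible \<Sigma>" "J_dual \<Sigma> \<delta> p \<le> J0" for p
    using feasible_sublevel_reduction[OF assms(2-4) t _ \<beta>(2), where M = M] that
    unfolding R_def J0_def M_def by (cases p) (metis max.cobounded2)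
  have sub: "R \<subseteq> feasible \<Sigma>"
    unfolding R_def using t0 \<beta>(1) by (intro restricted_feasible_subset) auto
  have "compact R"
    unfolding R_def using t0 by (intro compact_restricted_feasible) simp
  \<comment> \<open>Reducing the reference point shows that \<open>R\<close> is nonempty and attains
    the value \<open>J0\<close>.\<close>
  moreover obtain p1 where p1: "p1 \<in> R" "J_dual \<Sigma> \<delta> p1 = J0" using red[OF p0(1)] p0 by auto
  moreover have "continuous_on R (J_dual \<Sigma> \<delta>)"
    using continuous_on_J_dual sub by (rule continuous_on_subset)
  ultimately obtain p where p: "p \<in> R" "\<And>q. q \<in> R \<Longrightarrow> J_dual \<Sigma> \<delta> p \<le> J_dual \<Sigma> \<delta> q"
    using continuous_attains_inf[of R "J_dual \<Sigma> \<delta>"] by blast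
  \<comment> \<open>Points with value at most \<open>J0\<close> are matched by points of
    \<open>R\<close>; all others are beaten by \<open>p1\<close>.\<close>
  have min: "J_dual \<Sigma> \<delta> p \<le> J_dual \<Sigma> \<delta> q" if "q \<in> feasible \<Sigma>" for q
  proof (cases "J_dual \<Sigma> \<delta> q \<le> J0")
    case True
    then show ?thesis using red[OF that] p(2) by metis
  next
    case False
    then show ?thesis using p(2)[OF p1(1)] p1(2) by simp
  qed
  \<comment> \<open>Both infima are minima attained at the same p, which lies in both sets.\<close>
  have "(INF q\<in>feasible \<Sigma>. J_dual \<Sigma> \<delta> q) = J_dual \<Sigma> \<delta> p"
    using p(1) sub min by (intro cInf_eq_minimum) auto
  moreover have "(INF q\<in>R. J_dual \<Sigma> \<delta> q) = J_dual \<Sigma> \<delta> p"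
    using p by (intro cInf_eq_minimum) auto
  ultimately have inf: "(INF q\<in>feasible \<Sigma>. J_dual \<Sigma> \<delta> q) = (INF q\<in>R. J_dual \<Sigma> \<delta> q)"
    by (rule trans[OF _ sym])
  have argmin: "is_arg_min (J_dual \<Sigma> \<delta>) (\<lambda>q. q \<in> feasible \<Sigma>) p"
    "is_arg_min (J_dual \<Sigma> \<delta>) (\<lambda>q. q \<in> R) p"
    using p sub min by (auto simp: is_arg_min_linorder)
  have "inverse t > 0" "inverse t \<le> M" "M * t > 0"
    using t0 by (auto simp: M_def less_max_iff_disj)
  note concl = this \<beta>(1) sub inf exI[of "is_arg_min (J_dual \<Sigma> \<delta>) (\<lambda>q. q \<in> feasible \<Sigma>)", OF argmin(1)]
    exI[of "is_arg_min (J_dual \<Sigma> \<delta>) (\<lambda>q. q \<in> R)", OF argmin(2)]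
  show ?thesis
    by (rule exI[of _ "inverse t"], rule exI[of _ M], rule exI[of _ "- (M * t)"],
        rule exI[of _ "M * t"], rule exI[of _ \<beta>], fold R_def, intro conjI concl)
qed

end
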